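(* There is an absolute constant $C>0$ such that the following holds. Let $n\ge 2$, $d\ge 1$, $\sigma>0$, and let $n$ agents with positions $p_1(k),\dots,p_n(k)\in\mathbb{R}^d$, $k=0,1,2,\dots$, move according to $$p_i(k+1)=p_i(k)-\sigma\sum_{j=1}^{n} f\bigl(p_i(k)-p_j(k)\bigr),\qquad f(x)=\begin{cases}\dfrac{x}{\|x\|}, & x\neq 0,\\[1ex] 0,& x=0.\end{cases}$$ Let $\bar p=\frac1n\sum_{j}p_j(0)$ (which equals $\frac1n\sum_j p_j(k)$ for all $k$). Then, for any initial constellation, all agents gather in a finite number of time-steps to a disc centered at $\bar p$ with radius of order $\sigma n^2$: there is a finite $K$ such that $\|p_i(k)-\bar p\|\le C\sigma n^2$ for all $i$ and all $k> K$.
   Context: This is the discrete-time system $\mathcal{S}_4$ (unlimited visibility, bearing-only sensing): at each time-step all agents simultaneously jump by $\sigma$ times the sum of the unit vectors pointing to the other agents. $\|\cdot\|$ is the Euclidean norm. *)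

theory Defs
  imports "HOL-Analysis.Analysis"
begin

text \<open>
  The constant of the theorem is independent of the dimension, so it has to be quantified outside
  of it, which a type-indexed \<open>real ^ 'd\<close> does not allow. A vector of dimension \<open>d\<close> is therefore
  the family of its coordinates \<open>x c\<close> with \<open>c \<in> {1..d}\<close>, given by a function
  \<open>nat \<Rightarrow> real\<close> whose values elsewhere are irrelevant. A constellation of \<open>n\<close> agents
  is a function \<open>nat \<Rightarrow> nat \<Rightarrow> real\<close>: agent \<open>i \<in> {1..n}\<close>, then coordinate.
\<close>

definition eucl_norm :: "nat \<Rightarrow> (nat \<Rightarrow> real) \<Rightarrow> real" where
  "eucl_norm d x = L2_set x {1..d}"

definition bearing :: "nat \<Rightarrow> (nat \<Rightarrow> real) \<Rightarrow> nat \<Rightarrow> real" where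
  "bearing d x = (if \<forall>c\<in>{1..d}. x c = 0 then (\<lambda>c. 0) else (\<lambda>c. x c / eucl_norm d x))"

definition bearing_only_motion ::
    "nat \<Rightarrow> nat \<Rightarrow> real \<Rightarrow> (nat \<Rightarrow> nat \<Rightarrow> nat \<Rightarrow> real) \<Rightarrow> bool" where
  "bearing_only_motion n d \<sigma> p \<longleftrightarrow>
     (\<forall>k. \<forall>i\<in>{1..n}. \<forall>c\<in>{1..d}.
        p (Suc k) i c = p k i c - \<sigma> * (\<Sum>j=1..n. bearing d (\<lambda>b. p k i b - p k j b) c))"

definition centroid :: "nat \<Rightarrow> (nat \<Rightarrow> nat \<Rightarrow> real) \<Rightarrow> nat \<Rightarrow> real" where
  "centroid n P = (\<lambda>c. (1 / real n) * (\<Sum>j=1..n. P j c))"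

end

theory Submission
  imports Defs
begin

text \<open>
  Place the centroid at the origin and let \<open>V\<close> be the sum of the squared norms of the positions.
  A step changes \<open>V\<close> by \<open>- 2\<sigma>S + \<sigma>\<^sup>2 \<Sum>\<^sub>i \<parallel>F\<^sub>i\<parallel>\<^sup>2\<close>, where \<open>S\<close> is the sum of the distances over unordered
  pairs of agents and \<open>F\<^sub>i\<close>, a sum of at most \<open>n\<close> unit vectors, has norm at most \<open>n\<close>. As the
  centroid vanishes, \<open>\<Sum>\<^sub>j \<parallel>p\<^sub>i - p\<^sub>j\<parallel> \<ge> n \<parallel>p\<^sub>i\<parallel>\<close>, so \<open>2S \<ge> n sqrt V\<close>. Hence \<open>V\<close> drops by at least
  \<open>\<sigma>\<^sup>2 n\<^sup>3\<close> whenever \<open>sqrt V > 2\<sigma>n\<^sup>2\<close>, and the ball \<open>sqrt V \<le> 2\<sigma>n\<^sup>2\<close> is invariant.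
\<close>

lemma L2_set_power2: "(L2_set x A)\<^sup>2 = (\<Sum>c\<in>A. (x c)\<^sup>2)"
  by (simp add: L2_set_def sum_nonneg)

lemma L2_set_sum_le:
  "L2_set (\<lambda>c. \<Sum>j\<in>J. x j c) A \<le> (\<Sum>j\<in>J. L2_set (x j) A)"
proof (induction J rule: infinite_finite_induct)
  case (insert j J)
  have "L2_set (\<lambda>c. x j c + (\<Sum>i\<in>J. x i c)) A \<le> L2_set (x j) A + L2_set (\<lambda>c. \<Sum>i\<in>J. x i c) A"
    by (rule L2_set_triangle_ineq)
  with insert show ?case by simp
qed (simp_all add: L2_set_def)

lemma sum_antisym_zero:
  fixes g :: "'a \<Rightarrow> 'a \<Rightarrow> real"
  assumes "\<And>i j. g j i = - g i j"
  shows "(\<Sum>i\<in>A. \<Sum>j\<in>A. g i j) = 0"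
proof -
  have "(\<Sum>i\<in>A. \<Sum>j\<in>A. g i j) = (\<Sum>i\<in>A. \<Sum>j\<in>A. g j i)"
    by (rule sum.swap)
  also have "\<dots> = - (\<Sum>i\<in>A. \<Sum>j\<in>A. g i j)"
    by (subst assms) (simp add: sum_negf)
  finally show ?thesis by simp
qed

text \<open>Write \<open>2 * x i\<close> as \<open>(x i + x j) + (x i - x j)\<close>: the first part
  is symmetric, so its product with the antisymmetric \<open>g\<close> sums to zero. This turns the
  pairing of positions with forces into a sum over pairs of agents.\<close>

lemma sum_antisym_mult:
  fixes x :: "'a \<Rightarrow> real" and g :: "'a \<Rightarrow> 'a \<Rightarrow> real"
  assumes "\<And>i j. g j i = - g i j"
  shows "2 * (\<Sum>i\<in>A. x i * (\<Sum>j\<in>A. g i j)) = (\<Sum>i\<in>A. \<Sum>j\<in>A. g i j * (x i - x j))"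
proof -
  have "(\<Sum>i\<in>A. \<Sum>j\<in>A. (x i + x j) * g i j) = 0"
    by (rule sum_antisym_zero) (subst assms, simp add: algebra_simps)
  moreover have "2 * (\<Sum>i\<in>A. x i * (\<Sum>j\<in>A. g i j))
      = (\<Sum>i\<in>A. \<Sum>j\<in>A. (x i + x j) * g i j + g i j * (x i - x j))"
    unfolding sum_distrib_left by (intro sum.cong refl) (simp add: algebra_simps)
  ultimately show ?thesis
    by (simp add: sum.distrib)
qed

lemma bearing_minus: "bearing d (\<lambda>c. y c - x c) b = - bearing d (\<lambda>c. x c - y c) b"
proof -
  have "eucl_norm d (\<lambda>c. y c - x c) = eucl_norm d (\<lambda>c. x c - y c)"
    by (simp add: eucl_norm_def L2_set_def power2_commute)
  then show ?thesis
    by (auto simp: bearing_def minus_divide_left)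
qed

lemma eucl_norm_eq_0_iff: "eucl_norm d x = 0 \<longleftrightarrow> (\<forall>c\<in>{1..d}. x c = 0)"
  by (simp add: eucl_norm_def L2_set_eq_0_iff)

lemma eucl_norm_nonneg: "0 \<le> eucl_norm d x"
  by (simp add: eucl_norm_def)

lemma bearing_inner: "(\<Sum>c=1..d. bearing d x c * x c) = eucl_norm d x"
proof (cases "eucl_norm d x = 0")
  case False
  have "(\<Sum>c=1..d. bearing d x c * x c) = (\<Sum>c=1..d. (x c)\<^sup>2) / eucl_norm d x"
    using False by (auto simp: bearing_def eucl_norm_eq_0_iff sum_divide_distrib power2_eq_square)
  also have "\<dots> = (eucl_norm d x)\<^sup>2 / eucl_norm d x"
    by (simp only: eucl_norm_def L2_set_power2)
  finally show ?thesis using False by (simp add: power2_eq_square)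
qed (auto simp: bearing_def eucl_norm_eq_0_iff)

text \<open>Not an equality, since coincident agents contribute the zero vector.\<close>

lemma eucl_norm_bearing_le: "eucl_norm d (bearing d x) \<le> 1"
proof (cases "eucl_norm d x = 0")
  case False
  then have "bearing d x = (\<lambda>c. inverse (eucl_norm d x) * x c)"
    unfolding eucl_norm_eq_0_iff by (simp only: bearing_def if_False divide_inverse mult.commute)
  then have "eucl_norm d (bearing d x) = L2_set (\<lambda>c. inverse (eucl_norm d x) * x c) {1..d}"
    by (metis eucl_norm_def)
  also have "\<dots> = inverse (eucl_norm d x) * eucl_norm d x"
    unfolding eucl_norm_def by (intro L2_set_right_distrib [symmetric]) simp
  finally show ?thesis using False by simp
qed (auto simp: bearing_def eucl_norm_eq_0_iff eucl_norm_def L2_set_def)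

lemma eucl_norm_sum_bearing_le:
  "eucl_norm d (\<lambda>c. \<Sum>j=1..n. bearing d (x j) c) \<le> real n"
proof -
  have "eucl_norm d (\<lambda>c. \<Sum>j=1..n. bearing d (x j) c) \<le> (\<Sum>j=1..n. eucl_norm d (bearing d (x j)))"
    unfolding eucl_norm_def by (rule L2_set_sum_le)
  also have "\<dots> \<le> (\<Sum>j=1..n. 1)"
    by (intro sum_mono eucl_norm_bearing_le)
  finally show ?thesis by simp
qed

text \<open>This is \<open>sqrt V\<close>, the Euclidean norm of the whole constellation seen as one
  vector with \<open>n * d\<close> coordinates.\<close>

definition spread :: "nat \<Rightarrow> nat \<Rightarrow> (nat \<Rightarrow> nat \<Rightarrow> real) \<Rightarrow> real" where
  "spread n d x = L2_set (\<lambda>i. eucl_norm d (x i)) {1..n}"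

lemma spread_power2: "(spread n d x)\<^sup>2 = (\<Sum>i=1..n. \<Sum>c=1..d. (x i c)\<^sup>2)"
  by (simp add: spread_def eucl_norm_def L2_set_power2)

text \<open>Since the positions sum to zero, \<open>n\<close> times \<open>x i\<close> is the sum of
  the differences to all agents, and the triangle inequality applies. Summing over \<open>i\<close>
  bounds the l1 norm of the family of norms, which dominates its l2 norm.\<close>

lemma spread_le_sum_dist:
  assumes "\<And>c. c \<in> {1..d} \<Longrightarrow> (\<Sum>j=1..n. x j c) = 0"
  shows "real n * spread n d x \<le> (\<Sum>i=1..n. \<Sum>j=1..n. eucl_norm d (\<lambda>c. x i c - x j c))"
proof -
  have "real n * eucl_norm d (x i) \<le> (\<Sum>j=1..n. eucl_norm d (\<lambda>c. x i c - x j c))" for i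
  proof -
    have "real n * eucl_norm d (x i) = L2_set (\<lambda>c. real n * x i c) {1..d}"
      unfolding eucl_norm_def by (intro L2_set_right_distrib) simp
    also have "\<dots> = L2_set (\<lambda>c. \<Sum>j=1..n. x i c - x j c) {1..d}"
      by (intro L2_set_cong) (simp_all add: sum_subtractf assms del: One_nat_def)
    also have "\<dots> \<le> (\<Sum>j=1..n. eucl_norm d (\<lambda>c. x i c - x j c))"
      unfolding eucl_norm_def by (rule L2_set_sum_le)
    finally show ?thesis .
  qed
  then have "real n * (\<Sum>i=1..n. eucl_norm d (x i))
      \<le> (\<Sum>i=1..n. \<Sum>j=1..n. eucl_norm d (\<lambda>c. x i c - x j c))"
    unfolding sum_distrib_left by (intro sum_mono)
  moreover have "spread n d x \<le> (\<Sum>i=1..n. eucl_norm d (x i))"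
    unfolding spread_def by (intro L2_set_le_sum eucl_norm_nonneg)
  ultimately show ?thesis
    by (meson mult_left_mono of_nat_0_le_iff order_trans)
qed

text \<open>Expanding the square leaves a cross term, bounded below through the pairwise distances,
  and a quadratic term, in which each of the \<open>n\<close> agents contributes at most
  \<open>n ^ 2\<close>.\<close>

lemma spread_step:
  assumes "\<sigma> > 0"
    and centred: "\<And>c. c \<in> {1..d} \<Longrightarrow> (\<Sum>j=1..n. x j c) = 0"
    and step: "\<And>i c. i \<in> {1..n} \<Longrightarrow> c \<in> {1..d} \<Longrightarrow>
      y i c = x i c - \<sigma> * (\<Sum>j=1..n. bearing d (\<lambda>b. x i b - x j b) c)"
  shows "(spread n d y)\<^sup>2 \<le> (spread n d x)\<^sup>2 - \<sigma> * real n * spread n d x + \<sigma>\<^sup>2 * real n ^ 3"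
proof -
  define g where "g i j = bearing d (\<lambda>b. x i b - x j b)" for i j
  define F where "F i c = (\<Sum>j=1..n. g i j c)" for i c
  have "(spread n d y)\<^sup>2 = (\<Sum>i=1..n. \<Sum>c=1..d. (x i c - \<sigma> * F i c)\<^sup>2)"
    unfolding spread_power2 by (intro sum.cong refl) (simp add: step F_def g_def)
  also have "\<dots> = (spread n d x)\<^sup>2 - \<sigma> * (2 * (\<Sum>i=1..n. \<Sum>c=1..d. x i c * F i c))
      + \<sigma>\<^sup>2 * (\<Sum>i=1..n. \<Sum>c=1..d. (F i c)\<^sup>2)"
    unfolding spread_power2
    by (simp add: power2_diff power_mult_distrib sum.distrib sum_subtractf sum_distrib_left algebra_simps)
  finally have expand: "(spread n d y)\<^sup>2 = \<dots>" .
  \<comment> \<open>The symmetrization is scalar, so it is done in each coordinate; the coordinate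
    sum is then moved innermost, where it becomes the inner product of a bearing with its own
    vector.\<close>
  have "2 * (\<Sum>i=1..n. \<Sum>c=1..d. x i c * F i c) = (\<Sum>c=1..d. 2 * (\<Sum>i=1..n. x i c * F i c))"
    by (subst sum.swap) (simp add: sum_distrib_left)
  also have "\<dots> = (\<Sum>c=1..d. \<Sum>i=1..n. \<Sum>j=1..n. g i j c * (x i c - x j c))"
    unfolding F_def g_def by (intro sum.cong refl sum_antisym_mult bearing_minus)
  also have "\<dots> = (\<Sum>i=1..n. \<Sum>c=1..d. \<Sum>j=1..n. g i j c * (x i c - x j c))"
    by (rule sum.swap)
  also have "\<dots> = (\<Sum>i=1..n. \<Sum>j=1..n. \<Sum>c=1..d. g i j c * (x i c - x j c))"
    by (intro sum.cong refl sum.swap)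
  also have "\<dots> = (\<Sum>i=1..n. \<Sum>j=1..n. eucl_norm d (\<lambda>c. x i c - x j c))"
    unfolding g_def by (intro sum.cong refl bearing_inner)
  also have "\<dots> \<ge> real n * spread n d x"
    using centred by (rule spread_le_sum_dist)
  finally have "\<sigma> * (real n * spread n d x) \<le> \<sigma> * (2 * (\<Sum>i=1..n. \<Sum>c=1..d. x i c * F i c))"
    using \<open>\<sigma> > 0\<close> by (intro mult_left_mono) auto
  moreover have "(\<Sum>c=1..d. (F i c)\<^sup>2) \<le> (real n)\<^sup>2" for i
  proof -
    have "eucl_norm d (F i) \<le> real n"
      unfolding F_def g_def by (rule eucl_norm_sum_bearing_le)
    then have "(eucl_norm d (F i))\<^sup>2 \<le> (real n)\<^sup>2"
      by (intro power_mono eucl_norm_nonneg)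
    then show ?thesis by (simp only: eucl_norm_def L2_set_power2)
  qed
  then have "(\<Sum>i=1..n. \<Sum>c=1..d. (F i c)\<^sup>2) \<le> (\<Sum>i=1..n. (real n)\<^sup>2)"
    by (intro sum_mono)
  then have "\<sigma>\<^sup>2 * (\<Sum>i=1..n. \<Sum>c=1..d. (F i c)\<^sup>2) \<le> \<sigma>\<^sup>2 * real n ^ 3"
    by (intro mult_left_mono) (simp_all add: power2_eq_square power3_eq_cube)
  ultimately show ?thesis
    using expand by simp
qed

text \<open>Staying above \<open>B\<close> forever would push \<open>V\<close> below zero after
  finitely many drops; once at or below \<open>B\<close>, it is trapped by
  \<open>stay\<close>.\<close>

lemma eventually_le_if_decreasing:
  fixes V :: "nat \<Rightarrow> real"
  assumes "\<delta> > 0" and nonneg: "\<And>k. V k \<ge> 0"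
    and drop: "\<And>k. V k > B \<Longrightarrow> V (Suc k) \<le> V k - \<delta>"
    and stay: "\<And>k. V k \<le> B \<Longrightarrow> V (Suc k) \<le> B"
  shows "\<exists>K. \<forall>k>K. V k \<le> B"
proof -
  have "\<exists>K. V K \<le> B"
  proof (rule ccontr)
    assume "\<nexists>K. V K \<le> B"
    then have above: "V k > B" for k by (simp add: not_le)
    have "V k \<le> V 0 - real k * \<delta>" for k
    proof (induction k)
      case (Suc k)
      with drop [OF above, of k] show ?case by (simp add: algebra_simps)
    qed simp
    moreover obtain k where "V 0 < real k * \<delta>"
      using reals_Archimedean3 [OF \<open>\<delta> > 0\<close>] by blast
    ultimately show False
      using nonneg [of k] by (smt (verit))
  qed
  then obtain K where "V K \<le> B" ..
  have "V k \<le> B" if "k \<ge> K" for k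
    using that \<open>V K \<le> B\<close> by (induction k rule: dec_induct) (auto intro: stay)
  then show ?thesis by (meson less_imp_le)
qed

text \<open>The pull of \<open>j\<close> on \<open>i\<close> is opposite to that of \<open>i\<close>
  on \<open>j\<close>, so the displacements cancel in total.\<close>

lemma centroid_const:
  assumes "bearing_only_motion n d \<sigma> p" and "c \<in> {1..d}"
  shows "centroid n (p k) c = centroid n (p 0) c"
proof (induction k)
  case (Suc k)
  have "(\<Sum>i=1..n. \<Sum>j=1..n. bearing d (\<lambda>b. p k i b - p k j b) c) = 0"
    by (rule sum_antisym_zero) (rule bearing_minus)
  then have "(\<Sum>i=1..n. p (Suc k) i c) = (\<Sum>i=1..n. p k i c)"
    using assms by (simp add: bearing_only_motion_def sum_subtractf flip: sum_distrib_left)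
  with Suc show ?case by (simp add: centroid_def)
qed simp

theorem theorem4:
  "\<exists>C::real. C > 0 \<and>
     (\<forall>(n::nat) (d::nat) (\<sigma>::real) (p :: nat \<Rightarrow> nat \<Rightarrow> nat \<Rightarrow> real).
        n \<ge> 2 \<longrightarrow> d \<ge> 1 \<longrightarrow> \<sigma> > 0 \<longrightarrow> bearing_only_motion n d \<sigma> p \<longrightarrow>
          (\<forall>k. \<forall>c\<in>{1..d}. centroid n (p k) c = centroid n (p 0) c) \<and>
          (\<exists>K::nat. \<forall>k>K. \<forall>i\<in>{1..n}.
             eucl_norm d (\<lambda>c. p k i c - centroid n (p 0) c) \<le> C * \<sigma> * (real n)\<^sup>2))"
proof (rule exI [of _ 2], intro conjI allI impI)
  fix n d :: nat and \<sigma> :: real and p :: "nat \<Rightarrow> nat \<Rightarrow> nat \<Rightarrow> real"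
  assume "n \<ge> 2" "d \<ge> 1" "\<sigma> > 0" and motion: "bearing_only_motion n d \<sigma> p"
  show "\<forall>c\<in>{1..d}. centroid n (p k) c = centroid n (p 0) c" for k
    using centroid_const [OF motion] by blast
  define x where "x k i c = p k i c - centroid n (p 0) c" for k i c
  define r where "r k = spread n d (x k)" for k
  \<comment> \<open>At \<open>r k = R / 2\<close> the linear decrease in the one-step bound exactly
    balances the error \<open>\<sigma>\<^sup>2 * n ^ 3\<close>; the factor 2 leaves a net drop of
    that same amount beyond \<open>R\<close>.\<close>
  define R where "R = 2 * \<sigma> * (real n)\<^sup>2"
  have r_nonneg: "r k \<ge> 0" for k by (simp add: r_def spread_def)
  have "R \<ge> 0" using \<open>\<sigma> > 0\<close> by (simp add: R_def)
  have pos: "\<sigma>\<^sup>2 * real n ^ 3 > 0" using \<open>\<sigma> > 0\<close> \<open>n \<ge> 2\<close> by simp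
  \<comment> \<open>Subtracting the initial centroid centres every later constellation too, because
    the centroid is constant.\<close>
  have centred: "(\<Sum>j=1..n. x k j c) = 0" if "c \<in> {1..d}" for k c
    using centroid_const [OF motion that, of k] \<open>n \<ge> 2\<close>
    by (simp add: x_def sum_subtractf centroid_def)
  have step: "(r (Suc k))\<^sup>2 \<le> (r k)\<^sup>2 - \<sigma> * real n * r k + \<sigma>\<^sup>2 * real n ^ 3" for k
    unfolding r_def using \<open>\<sigma> > 0\<close> centred
    by (rule spread_step) (use motion in \<open>simp_all add: bearing_only_motion_def x_def\<close>)
  have half: "\<sigma> * real n * (R / 2) = \<sigma>\<^sup>2 * real n ^ 3"
    by (simp add: R_def power2_eq_square power3_eq_cube)
  have "\<exists>K. \<forall>k>K. (r k)\<^sup>2 \<le> R\<^sup>2"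
  proof (rule eventually_le_if_decreasing [OF pos])
    fix k
    have mono: "\<sigma> * real n * a \<le> \<sigma> * real n * r k" if "a \<le> r k" for a
      using that \<open>\<sigma> > 0\<close> by (intro mult_left_mono) auto
    show "(r (Suc k))\<^sup>2 \<le> (r k)\<^sup>2 - \<sigma>\<^sup>2 * real n ^ 3" if "(r k)\<^sup>2 > R\<^sup>2"
    proof -
      have "R \<le> r k" using power2_less_imp_less [OF that r_nonneg] by simp
      then show ?thesis using mono step [of k] half by fastforce
    qed
    show "(r (Suc k))\<^sup>2 \<le> R\<^sup>2" if "(r k)\<^sup>2 \<le> R\<^sup>2"
    proof (cases "R / 2 \<le> r k")
      \<comment> \<open>Past the balance point the squared spread cannot increase.\<close>
      case True
      then show ?thesis using mono step [of k] half that by fastforce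
    next
      case False
      \<comment> \<open>Here the squared spread may grow, but it starts at most at
        \<open>R\<^sup>2 / 4\<close> and gains at most \<open>\<sigma>\<^sup>2 * n ^ 3\<close>,
        which is at most \<open>\<sigma>\<^sup>2 * n ^ 4 = R\<^sup>2 / 4\<close>.\<close>
      have "(r k)\<^sup>2 \<le> (R / 2)\<^sup>2"
        using False r_nonneg by (intro power_mono) auto
      moreover have "0 \<le> \<sigma> * real n * r k"
        using \<open>\<sigma> > 0\<close> r_nonneg by simp
      moreover have "\<sigma>\<^sup>2 * real n ^ 3 \<le> \<sigma>\<^sup>2 * real n ^ 4"
        using \<open>n \<ge> 2\<close> by (intro mult_left_mono power_increasing) auto
      moreover have "R\<^sup>2 = 4 * (\<sigma>\<^sup>2 * real n ^ 4)"
        by (simp add: R_def power_mult_distrib)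
      moreover have "(R / 2)\<^sup>2 = \<sigma>\<^sup>2 * real n ^ 4"
        by (simp add: R_def power_mult_distrib)
      moreover have "0 \<le> \<sigma>\<^sup>2 * real n ^ 4" by simp
      ultimately show ?thesis using step [of k] by linarith
    qed
  qed simp
  then obtain K where K: "(r k)\<^sup>2 \<le> R\<^sup>2" if "k > K" for k by blast
  have "eucl_norm d (x k i) \<le> R" if "k > K" "i \<in> {1..n}" for k i
  proof -
    have "eucl_norm d (x k i) \<le> r k"
      unfolding r_def spread_def using that by (intro member_le_L2_set) auto
    also have "r k \<le> R"
      using K [OF that(1)] \<open>R \<ge> 0\<close> by (rule power2_le_imp_le)
    finally show ?thesis .
  qed
  then show "\<exists>K. \<forall>k>K. \<forall>i\<in>{1..n}.
      eucl_norm d (\<lambda>c. p k i c - centroid n (p 0) c) \<le> 2 * \<sigma> * (real n)\<^sup>2"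
    unfolding x_def R_def by blast
qed simp

end
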